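(* Let $0<\alpha<1$, $\mu>0$, $0<x_1^*<x_2^*<\dots<x_m^*<l$. To the problem $$\partial^\alpha_{0t}u=u_{xx}+\mu u_{xxt}+\sum_{k=1}^m q_k(x,t)u(x_k^*,t)+f(x,t),\quad 0<x<l,\ 0<t\le T,$$ $$u(0,t)=u(l,t)=0\ (0\le t\le T),\qquad u(x,0)=u_0(x)\ (0\le x\le l),$$ associate, on the uniform grid with steps $h=l/N$, $\tau=T/M$, where $h<\min\{x_1^*,\,l-x_m^*\}$, the compact difference scheme $$\Delta^{\alpha}_{0t_{j+1/2}}(\mathcal H_h y)_i=Y^{j+1}_{\bar xx,i}+\mu\,y^j_{\bar xxt,i}+\mathcal H_h\Big(\sum_{k=1}^m q_k(\cdot,t_{j+1/2})\,\bar Y^{j+1}_{i_k}\Big)_i+(\mathcal H_h\varphi^{j+1/2})_i,$$ $i=1,\dots,N-1$, $j=0,\dots,M-1$, with $$y_0^{j+1}=y_N^{j+1}=0\ \ (j=0,\dots,M-1),\qquad y_i^0=u_0(x_i)\ \ (i=0,\dots,N),$$ where $\varphi_i^{j+1/2}=f(x_i,t_{j+1/2})$. Let $|q_k(x,t)|<c_1$ for $k=1,2,\dots,m$. Then there is a $\tau_0$ such that, if $\tau\le\tau_0$, the solution of the difference problem satisfies the a priori estimate $$\|y^{j+1}_{\bar x}]|_0^2\le M(T)\Big(\sum_{j'=0}^{j}\|\mathcal H_h\varphi^{j'+1/2}\|_0^2\,\tau+\|y^0\|_0^2+\|y^0_{\bar x}]|_0^2\Big),$$ where $M(T)>0$ is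 a constant which does not depend on $h$ and $\tau$.
   Context: $\partial^\alpha_{0t}u(x,t)=\frac1{\Gamma(1-\alpha)}\int_0^t\frac{\partial u(x,\eta)}{\partial\eta}(t-\eta)^{-\alpha}d\eta$ is the Caputo derivative. Grid: $x_i=ih$ ($0\le i\le N$), $t_j=j\tau$ ($0\le j\le M$), $t_{j+1/2}=(j+\tfrac12)\tau$. The points $x_k^*$ are the fixed loading points. (The number $M$ of time steps is unrelated to the constant $M(T)$.) Difference quotients: $y_{\bar x,i}=(y_i-y_{i-1})/h$; $y_{\bar xx,i}=(y_{i+1}-2y_i+y_{i-1})/h^2$; $y^j_{\bar xxt,i}=(y^{j+1}_{\bar xx,i}-y^{j}_{\bar xx,i})/\tau$. Time average: $Y^{j+1}=\tfrac12(y^{j+1}+y^j)$. Compact operator: $(\mathcal H_h v)_i=\tfrac1{12}(v_{i+1}+10v_i+v_{i-1})$ for $1\le i\le N-1$ (applied to functions of $x$ through their values at the nodes). Discrete fractional derivative at $t_{j+1/2}$: $$\Delta^\alpha_{0t_{j+1/2}}v=\frac{\tau^{1-\alpha}}{\Gamma(2-\alpha)}\sum_{s=0}^j c^{(\alpha)}_{j-s}\,\frac{v^{s+1}-v^s}{\tau},\qquad c_0^{(\alpha)}=\frac1{2^{1-\alpha}},\quad c_n^{(\alpha)}=(n+\tfrac12)^{1-\alpha}-(n-\tfrac12)^{1-\alpha}\ (n\ge1).$$ Interpolation at loading points: for each $k$, $i_k$ is an index with $x_{i_k}\le x_k^*\le x_{i_k+1}$, and $\bar Y_{i_k}$ is the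 value at $x_k^*$ of the cubic Lagrange interpolation polynomial through the nodes $x_{i_k-1},x_{i_k},x_{i_k+1},x_{i_k+2}$ with values $Y_{i_k-1},Y_{i_k},Y_{i_k+1},Y_{i_k+2}$ (these nodes lie in the grid because of the condition on $h$). Norms: $\|v\|_0^2=\sum_{i=1}^{N-1}v_i^2h$, $\|v_{\bar x}]|_0^2=\sum_{i=1}^{N}v_{\bar x,i}^2h$. *)

theory Defs
  imports "HOL-Analysis.Analysis"
begin

text \<open>
  A grid function in space is a map \<open>v :: nat \<Rightarrow> real\<close> of which only the values at the indices
  \<open>0, \<dots>, N\<close> matter; a grid function in space and time is a map \<open>y :: nat \<Rightarrow> nat \<Rightarrow> real\<close>
  with the time level first, so that \<open>y j i\<close> is the value at the node \<open>(i * h, j * \<tau>)\<close>.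
\<close>

definition diff_bwd :: "real \<Rightarrow> (nat \<Rightarrow> real) \<Rightarrow> nat \<Rightarrow> real" where
  "diff_bwd h v i = (v i - v (i - 1)) / h"

definition diff_xx :: "real \<Rightarrow> (nat \<Rightarrow> real) \<Rightarrow> nat \<Rightarrow> real" where
  "diff_xx h v i = (v (i + 1) - 2 * v i + v (i - 1)) / h\<^sup>2"

definition compact_op :: "(nat \<Rightarrow> real) \<Rightarrow> nat \<Rightarrow> real" where
  "compact_op v i = (v (i + 1) + 10 * v i + v (i - 1)) / 12"

definition norm0_sq :: "real \<Rightarrow> nat \<Rightarrow> (nat \<Rightarrow> real) \<Rightarrow> real" where
  "norm0_sq h N v = (\<Sum>i=1..N-1. (v i)\<^sup>2 * h)"

definition norm_bwd_sq :: "real \<Rightarrow> nat \<Rightarrow> (nat \<Rightarrow> real) \<Rightarrow> real" where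
  "norm_bwd_sq h N v = (\<Sum>i=1..N. (diff_bwd h v i)\<^sup>2 * h)"

definition t_mid :: "real \<Rightarrow> nat \<Rightarrow> real" where
  "t_mid \<tau> j = (real j + 1 / 2) * \<tau>"

text \<open>The average over the time step from level \<open>j\<close> to level \<open>j + 1\<close>, usually written \<open>Y\<close> with
  the index \<open>j + 1\<close>.\<close>

definition time_avg :: "(nat \<Rightarrow> nat \<Rightarrow> real) \<Rightarrow> nat \<Rightarrow> nat \<Rightarrow> real" where
  "time_avg y j i = (y (j + 1) i + y j i) / 2"

definition frac_coeff :: "real \<Rightarrow> nat \<Rightarrow> real" where
  "frac_coeff \<alpha> n =
     (if n = 0 then 1 / 2 powr (1 - \<alpha>)
      else (real n + 1 / 2) powr (1 - \<alpha>) - (real n - 1 / 2) powr (1 - \<alpha>))"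

text \<open>The discrete Caputo derivative of order \<open>\<alpha>\<close> at the time \<open>t_mid \<tau> j\<close>.\<close>

definition frac_diff :: "real \<Rightarrow> real \<Rightarrow> (nat \<Rightarrow> real) \<Rightarrow> nat \<Rightarrow> real" where
  "frac_diff \<alpha> \<tau> v j =
     \<tau> powr (1 - \<alpha>) / Gamma (2 - \<alpha>) *
       (\<Sum>s=0..j. frac_coeff \<alpha> (j - s) * ((v (s + 1) - v s) / \<tau>))"

definition lagrange_interp :: "nat set \<Rightarrow> (nat \<Rightarrow> real) \<Rightarrow> (nat \<Rightarrow> real) \<Rightarrow> real \<Rightarrow> real" where
  "lagrange_interp S x v z =
     (\<Sum>r\<in>S. v r * (\<Prod>s\<in>S - {r}. (z - x s) / (x r - x s)))"

text \<open>The four nodes have the indices \<open>p - 1, p, p + 1, p + 2\<close>; this needs \<open>1 \<le> p\<close>, since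
  the subtraction is truncated.\<close>

definition cubic_interp :: "real \<Rightarrow> nat \<Rightarrow> (nat \<Rightarrow> real) \<Rightarrow> real \<Rightarrow> real" where
  "cubic_interp h p v z = lagrange_interp {p - 1..p + 2} (\<lambda>i. real i * h) v z"

text \<open>\<open>p k\<close> is the index of a grid interval containing the loading point \<open>xl k\<close>. It is not
  unique when \<open>xl k\<close> is a node.\<close>

definition loading_indices :: "real \<Rightarrow> nat \<Rightarrow> (nat \<Rightarrow> real) \<Rightarrow> (nat \<Rightarrow> nat) \<Rightarrow> bool" where
  "loading_indices h m xl p \<longleftrightarrow>
     (\<forall>k\<in>{1..m}. real (p k) * h \<le> xl k \<and> xl k \<le> real (p k + 1) * h)"

definition solves_scheme ::
  "real \<Rightarrow> real \<Rightarrow> real \<Rightarrow> real \<Rightarrow> nat \<Rightarrow> nat \<Rightarrow> nat \<Rightarrow> (nat \<Rightarrow> real) \<Rightarrow> (nat \<Rightarrow> nat) \<Rightarrow>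
   (nat \<Rightarrow> real \<Rightarrow> real \<Rightarrow> real) \<Rightarrow> (real \<Rightarrow> real \<Rightarrow> real) \<Rightarrow> (real \<Rightarrow> real) \<Rightarrow>
   (nat \<Rightarrow> nat \<Rightarrow> real) \<Rightarrow> bool" where
  "solves_scheme \<alpha> \<mu> h \<tau> N M m xl p q f u0 y \<longleftrightarrow>
     (\<forall>j<M. \<forall>i\<in>{1..N-1}.
        frac_diff \<alpha> \<tau> (\<lambda>s. compact_op (y s) i) j =
          diff_xx h (time_avg y j) i
          + \<mu> * ((diff_xx h (y (j + 1)) i - diff_xx h (y j) i) / \<tau>)
          + compact_op (\<lambda>n. \<Sum>k=1..m. q k (real n * h) (t_mid \<tau> j) *
                                    cubic_interp h (p k) (time_avg y j) (xl k)) i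
          + compact_op (\<lambda>n. f (real n * h) (t_mid \<tau> j)) i) \<and>
     (\<forall>j<M. y (j + 1) 0 = 0 \<and> y (j + 1) N = 0) \<and>
     (\<forall>i\<le>N. y 0 i = u0 (real i * h))"

end

theory Submission
  imports Defs
begin

text \<open>
  The scheme is summed over the time levels \<open>0, \<dots>, J\<close> and then tested with \<open>y (J + 1)\<close>. Testing level
  by level is avoided because \<open>y 0\<close> need not vanish at the end points, so that the first time
  difference is not an admissible test function. As the partial sums of the coefficients telescope
  to \<open>(r + 1/2) powr (1 - \<alpha>)\<close>, the summed fractional derivative is a weakly singular convolution
  of the values \<open>y s\<close>, in which no time difference is left. The pseudo-parabolic term alone gives
  coercivity, so no positivity of the fractional derivative is used, and a Gronwall argument with
  the weight \<open>exp (- L * t)\<close> absorbs the convolution when \<open>\<tau>\<close> is small.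
\<close>

section \<open>Coefficients of the discrete Caputo derivative and its sum over the time
  levels\<close>

lemma frac_coeff_nonneg:
  assumes "\<alpha> < 1"
  shows "0 \<le> frac_coeff \<alpha> n"
  using assms by (auto simp: frac_coeff_def intro!: powr_mono2)

text \<open>The coefficient with index 0 is \<open>(1/2) powr (1 - \<alpha>)\<close>, exactly the
  value from which the differences defining the later coefficients start, so everything
  telescopes.\<close>

lemma sum_frac_coeff: "(\<Sum>n=0..r. frac_coeff \<alpha> n) = (real r + 1/2) powr (1 - \<alpha>)"
proof (induction r)
  case 0
  then show ?case by (simp add: frac_coeff_def powr_divide)
next
  case (Suc r)
  have "frac_coeff \<alpha> (Suc r) = (real (Suc r) + 1/2) powr (1 - \<alpha>) - (real r + 1/2) powr (1 - \<alpha>)"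
    by (simp add: frac_coeff_def algebra_simps)
  with Suc show ?case by simp
qed

text \<open>At each level the convolution with \<open>v s\<close> is, after an index shift, the
  convolution with \<open>v (s + 1)\<close> one level earlier plus a multiple of \<open>v 0\<close>.
  Hence the sum over the levels telescopes, leaving only the last convolution and the contributions
  of \<open>v 0\<close>.\<close>

lemma sum_convolution_diff:
  fixes c v :: "nat \<Rightarrow> real"
  shows "(\<Sum>j=0..J. \<Sum>s=0..j. c (j - s) * (v (s + 1) - v s)) =
    (\<Sum>s=0..J. c (J - s) * v (s + 1)) - (\<Sum>n=0..J. c n) * v 0"
proof (induction J)
  case 0
  then show ?case by (simp add: algebra_simps)
next
  case (Suc J)
  have "(\<Sum>s=0..Suc J. c (Suc J - s) * v s) = c (Suc J) * v 0 + (\<Sum>s=0..J. c (J - s) * v (s + 1))"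
    by (simp add: sum.atLeast0_atMost_Suc_shift del: sum.cl_ivl_Suc)
  then have "(\<Sum>s=0..Suc J. c (Suc J - s) * (v (s + 1) - v s)) =
      (\<Sum>s=0..Suc J. c (Suc J - s) * v (s + 1)) - c (Suc J) * v 0 - (\<Sum>s=0..J. c (J - s) * v (s + 1))"
    by (simp add: right_diff_distrib sum_subtractf del: sum.cl_ivl_Suc)
  moreover have "(\<Sum>n=0..Suc J. c n) * v 0 = (\<Sum>n=0..J. c n) * v 0 + c (Suc J) * v 0"
    by (simp add: algebra_simps)
  ultimately show ?case
    using Suc by (simp only: sum.atLeast0_atMost_Suc[of "\<lambda>j. \<Sum>s=0..j. c (j - s) * (v (s + 1) - v s)"])
qed

lemma sum_frac_diff:
  assumes "0 < \<tau>"
  shows "(\<Sum>j=0..J. \<tau> * frac_diff \<alpha> \<tau> v j) =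
    \<tau> powr (1 - \<alpha>) / Gamma (2 - \<alpha>) *
      ((\<Sum>s=0..J. frac_coeff \<alpha> (J - s) * v (s + 1)) - (real J + 1/2) powr (1 - \<alpha>) * v 0)"
proof -
  have "\<tau> * frac_diff \<alpha> \<tau> v j = \<tau> powr (1 - \<alpha>) / Gamma (2 - \<alpha>) *
      (\<Sum>s=0..j. frac_coeff \<alpha> (j - s) * (v (s + 1) - v s))" for j
    using assms by (simp add: frac_diff_def sum_divide_distrib[symmetric])
  then show ?thesis
    by (simp only: sum_distrib_left[symmetric] sum_convolution_diff sum_frac_coeff)
qed

section \<open>A discrete Gronwall inequality with weakly singular kernel\<close>

text \<open>The kernel has small total mass over short time lags, and the weight
  \<open>exp (- L * t)\<close> damps the long ones; together the weighted kernel has mass at most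
  1/2, so the weighted maximum can be absorbed. The sum includes the term \<open>s = n\<close>,
  which is why \<open>\<tau>\<close> has to be small. \<open>\<tau>0\<close> and \<open>K\<close>
  depend on \<open>A\<close>, \<open>B\<close>, \<open>T\<close> and \<open>\<alpha>\<close>
  only.\<close>

lemma weakly_singular_gronwall:
  fixes A B T \<alpha> :: real
  assumes "0 \<le> A" "0 \<le> B" "0 < T" "\<alpha> < 1"
  shows "\<exists>\<tau>0>0. \<exists>K>0. \<forall>(E :: nat \<Rightarrow> real) D \<tau> J.
    0 < \<tau> \<longrightarrow> \<tau> \<le> \<tau>0 \<longrightarrow> real (Suc J) * \<tau> \<le> T \<longrightarrow> (\<forall>n. 0 \<le> E n) \<longrightarrow> 0 \<le> D \<longrightarrow>
    (\<forall>n\<le>J. E n \<le> D + (\<Sum>s=0..n. (B * \<tau> + A * \<tau> powr (1 - \<alpha>) * frac_coeff \<alpha> (n - s)) * E s)) \<longrightarrow>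
    E J \<le> K * D"
proof -
  \<comment> \<open>\<open>\<delta>\<close> serves both as the bound \<open>\<tau>0\<close> and as
    the border between short and long lags. The two entries of \<open>min\<close> make
    \<open>2 * B * \<delta>\<close> and \<open>A * (2 * \<delta>) powr (1 - \<alpha>)\<close> at
    most 1/8 each; \<open>B + 1\<close> and \<open>A + 1\<close> avoid division by zero.\<close>
  define \<delta> where "\<delta> = min (1 / (16 * (B + 1))) ((1 / (8 * (A + 1))) powr (1 / (1 - \<alpha>)) / 2)"
  have \<delta>: "0 < \<delta>" using assms by (auto simp: \<delta>_def)
  have small: "2 * B * \<delta> + A * (2 * \<delta>) powr (1 - \<alpha>) \<le> 1/4"
  proof -
    have "\<delta> \<le> 1 / (16 * (B + 1))" by (simp add: \<delta>_def)
    then have "2 * B * \<delta> \<le> 2 * B * (1 / (16 * (B + 1)))"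
      using assms by (intro mult_left_mono) auto
    also have "\<dots> \<le> 1/8" using assms by (simp add: field_simps)
    finally have 1: "2 * B * \<delta> \<le> 1/8" .
    have "2 * \<delta> \<le> (1 / (8 * (A + 1))) powr (1 / (1 - \<alpha>))"
      using min.cobounded2[of "1 / (16 * (B + 1))"] by (simp add: \<delta>_def min_def)
    then have "(2 * \<delta>) powr (1 - \<alpha>) \<le> ((1 / (8 * (A + 1))) powr (1 / (1 - \<alpha>))) powr (1 - \<alpha>)"
      using assms \<delta> by (intro powr_mono2) auto
    also have "\<dots> = 1 / (8 * (A + 1))" using assms by (simp add: powr_powr)
    finally have "A * (2 * \<delta>) powr (1 - \<alpha>) \<le> A * (1 / (8 * (A + 1)))"
      using assms by (intro mult_left_mono)
    also have "\<dots> \<le> 1/8" using assms by (simp add: field_simps)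
    finally show ?thesis using 1 by simp
  qed
  \<comment> \<open>\<open>C\<close> bounds the kernel mass over the whole interval of length
    \<open>T\<close>.\<close>
  define C where "C = B * T + A * T powr (1 - \<alpha>)"
  have C: "0 \<le> C" using assms by (simp add: C_def)
  \<comment> \<open>With this choice \<open>exp (L * \<delta>)\<close> is at least
    \<open>1 + 4 * C\<close>, so the damped mass of the long lags is at most 1/4.\<close>
  define L where "L = 4 * C / \<delta>"
  have L: "0 \<le> L" using C \<delta> by (simp add: L_def)
  have tail: "exp (- (L * \<delta>)) * C \<le> 1/4"
  proof -
    have "L * \<delta> = 4 * C" using \<delta> by (simp add: L_def)
    then have "4 * C \<le> exp (L * \<delta>)"
      using exp_ge_add_one_self[of "L * \<delta>"] by linarith
    then show ?thesis by (simp add: exp_minus field_simps)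
  qed
  show ?thesis
  proof (rule exI[of _ \<delta>], rule conjI[OF \<delta>], rule exI[of _ "2 * exp (L * T)"], intro conjI allI impI)
    show "0 < 2 * exp (L * T)" by simp
  next
    fix E :: "nat \<Rightarrow> real" and D \<tau> :: real and J
    assume \<tau>: "0 < \<tau>" "\<tau> \<le> \<delta>" "real (Suc J) * \<tau> \<le> T" and E: "\<forall>n. 0 \<le> E n" and D: "0 \<le> D"
      and step: "\<forall>n\<le>J.
        E n \<le> D + (\<Sum>s=0..n. (B * \<tau> + A * \<tau> powr (1 - \<alpha>) * frac_coeff \<alpha> (n - s)) * E s)"
    define k where "k r = B * \<tau> + A * \<tau> powr (1 - \<alpha>) * frac_coeff \<alpha> r" for r
    have k: "0 \<le> k r" for r using assms \<tau> frac_coeff_nonneg[of \<alpha> r] by (simp add: k_def)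
    \<comment> \<open>The first \<open>n + 1\<close> kernel values have a mass controlled by the
      elapsed time: \<open>\<tau> powr (1 - \<alpha>)\<close> merges with the telescoped sum into a
      power of \<open>\<tau> * (n + 1/2)\<close>.\<close>
    have sumk: "(\<Sum>r=0..n. k r) \<le> B * X + A * X powr (1 - \<alpha>)" if "(real n + 1) * \<tau> \<le> X" for n X
    proof -
      have "(\<Sum>r=0..n. k r) = B * ((real n + 1) * \<tau>) + A * (\<tau> * (real n + 1/2)) powr (1 - \<alpha>)"
        using \<tau> unfolding k_def sum.distrib sum_distrib_left[symmetric] sum_frac_coeff
        by (simp add: powr_mult)
      also have "\<dots> \<le> B * X + A * X powr (1 - \<alpha>)"
      proof (intro add_mono mult_left_mono powr_mono2)
        have "\<tau> * (real n + 1/2) \<le> (real n + 1) * \<tau>" using \<tau> by (simp add: algebra_simps)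
        then show "\<tau> * (real n + 1/2) \<le> X" using that by linarith
      qed (use assms \<tau> that in auto)
      finally show ?thesis .
    qed
    have weighted: "(\<Sum>r=0..n. k r * exp (- (L * (real r * \<tau>)))) \<le> 1/2" if n: "n \<le> J" for n
    proof -
      \<comment> \<open>\<open>R\<close> is the largest number of steps that fits into a lag of
        length \<open>\<delta>\<close>.\<close>
      define R where "R = nat \<lfloor>\<delta> / \<tau>\<rfloor>"
      have R: "real R * \<tau> \<le> \<delta>"
      proof -
        have "real R \<le> \<delta> / \<tau>" using \<delta> \<tau> by (simp add: R_def)
        then show ?thesis using \<tau> by (simp add: field_simps)
      qed
      have inR: "r \<le> R" if "real r * \<tau> \<le> \<delta>" for r
      proof -
        have "real r \<le> \<delta> / \<tau>" using that \<tau> by (simp add: field_simps)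
        then show ?thesis unfolding R_def by (meson le_nat_floor)
      qed
      \<comment> \<open>Short lags are bounded with weight 1, long ones with weight
        \<open>exp (- (L * \<delta>))\<close>; the second summand is kept for all \<open>r\<close>,
        so that the full mass bound \<open>C\<close> applies to it.\<close>
      have "(\<Sum>r=0..n. k r * exp (- (L * (real r * \<tau>)))) \<le>
          (\<Sum>r=0..n. (if r \<le> R then k r else 0) + exp (- (L * \<delta>)) * k r)"
      proof (rule sum_mono)
        fix r
        show "k r * exp (- (L * (real r * \<tau>))) \<le> (if r \<le> R then k r else 0) + exp (- (L * \<delta>)) * k r"
        proof (cases "r \<le> R")
          case True
          have "k r * exp (- (L * (real r * \<tau>))) \<le> k r * 1"
            using k L \<tau> by (intro mult_left_mono) auto
          moreover have "0 \<le> exp (- (L * \<delta>)) * k r" using k by simp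
          ultimately show ?thesis using True by simp
        next
          case False
          then have "\<delta> \<le> real r * \<tau>" using inR by force
          then have "L * \<delta> \<le> L * (real r * \<tau>)" using L by (intro mult_left_mono)
          then have "k r * exp (- (L * (real r * \<tau>))) \<le> k r * exp (- (L * \<delta>))"
            using k by (intro mult_left_mono) auto
          then show ?thesis using False by (simp add: mult.commute)
        qed
      qed
      also have "\<dots> = (\<Sum>r=0..n. if r \<le> R then k r else 0) + exp (- (L * \<delta>)) * (\<Sum>r=0..n. k r)"
        by (simp add: sum.distrib sum_distrib_left)
      also have "(\<Sum>r=0..n. if r \<le> R then k r else 0) = (\<Sum>r\<in>{r\<in>{0..n}. r \<le> R}. k r)"
        by (rule sum.inter_filter[symmetric]) simp
      also have "\<dots> \<le> (\<Sum>r=0..R. k r)" using k by (intro sum_mono2) auto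
      \<comment> \<open>The lags \<open>0, ..., R\<close> are \<open>R + 1\<close> steps, of total
        length at most \<open>\<delta> + \<tau>\<close>; here \<open>\<tau> \<le> \<delta>\<close>
        enters.\<close>
      also have "\<dots> \<le> B * (2 * \<delta>) + A * (2 * \<delta>) powr (1 - \<alpha>)"
        using R \<tau> by (intro sumk) (simp add: algebra_simps)
      also have "\<dots> \<le> 1/4" using small by (simp add: algebra_simps)
      also have "exp (- (L * \<delta>)) * (\<Sum>r=0..n. k r) \<le> exp (- (L * \<delta>)) * C"
        unfolding C_def
      proof (intro mult_left_mono sumk)
        have "(real n + 1) * \<tau> \<le> real (Suc J) * \<tau>" using n \<tau> by (intro mult_right_mono) auto
        then show "(real n + 1) * \<tau> \<le> T" using \<tau> by linarith
      qed simp
      also note tail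
      finally show ?thesis by simp
    qed
    \<comment> \<open>Evaluating the inequality at an index \<open>n\<close> where \<open>W\<close>
      is maximal replaces an induction and treats the implicit term \<open>s = n\<close> like all
      others.\<close>
    define W where "W s = E s * exp (- (L * (real s * \<tau>)))" for s
    have W: "0 \<le> W s" for s using E by (simp add: W_def)
    have "Max (W ` {0..J}) \<in> W ` {0..J}" by (rule Max_in) auto
    then obtain n where Max: "Max (W ` {0..J}) = W n" and "n \<in> {0..J}" by (rule imageE)
    then have n: "n \<le> J" by simp
    have max: "W s \<le> W n" if "s \<le> J" for s
      unfolding Max[symmetric] using that by (intro Max_ge) auto
    have "W n \<le> (D + (\<Sum>s=0..n. k (n - s) * E s)) * exp (- (L * (real n * \<tau>)))"
      unfolding W_def using step n by (intro mult_right_mono) (auto simp: k_def)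
    also have "\<dots> = D * exp (- (L * (real n * \<tau>))) +
        (\<Sum>s=0..n. k (n - s) * exp (- (L * (real (n - s) * \<tau>))) * W s)"
    \<comment> \<open>The weight is multiplicative: the factor for time \<open>n\<close> splits into
      one for the lag \<open>n - s\<close>, which goes to the kernel, and one for \<open>s\<close>,
      which turns \<open>E s\<close> into \<open>W s\<close>.\<close>
    proof -
      have "exp (- (L * (real n * \<tau>))) = exp (- (L * (real (n - s) * \<tau>))) * exp (- (L * (real s * \<tau>)))"
        if "s \<le> n" for s
        using that by (simp add: exp_add[symmetric] of_nat_diff algebra_simps)
      then show ?thesis
        by (auto simp: distrib_right sum_distrib_right W_def intro!: sum.cong)
    qed
    also have "\<dots> \<le> D * 1 + (\<Sum>s=0..n. k (n - s) * exp (- (L * (real (n - s) * \<tau>))) * W n)"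
      using D L \<tau> k n by (intro add_mono sum_mono mult_left_mono max) auto
    also have "(\<Sum>s=0..n. k (n - s) * exp (- (L * (real (n - s) * \<tau>))) * W n) =
        (\<Sum>r=0..n. k r * exp (- (L * (real r * \<tau>)))) * W n"
      unfolding sum_distrib_right[symmetric]
      by (subst sum.atLeastAtMost_rev) simp
    also have "\<dots> \<le> 1/2 * W n" using weighted[OF n] W by (intro mult_right_mono)
    finally have "W n \<le> 2 * D" by simp
    then have "W J \<le> 2 * D" using max[of J] by simp
    have "L * (real J * \<tau>) \<le> L * T"
      using L \<tau> by (intro mult_left_mono) (auto simp: algebra_simps)
    have "E J = W J * exp (L * (real J * \<tau>))"
      by (simp add: W_def exp_minus)
    also have "\<dots> \<le> (2 * D) * exp (L * T)"
      using \<open>W J \<le> 2 * D\<close> \<open>L * (real J * \<tau>) \<le> L * T\<close> D by (intro mult_mono) auto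
    finally show "E J \<le> 2 * exp (L * T) * D" by (simp add: algebra_simps)
  qed
qed

section \<open>Maximum-norm bounds for the interpolation and the compact operator\<close>

text \<open>Since \<open>z\<close> lies in the middle interval, it is within \<open>2 * h\<close> of
  every node, while distinct nodes are at least \<open>h\<close> apart. So each of the four Lagrange
  basis polynomials has three factors of size at most 2, which gives \<open>4 * 2 ^ 3 = 32\<close>,
  independently of \<open>h\<close>.\<close>

lemma cubic_interp_bound:
  assumes "0 < h" "1 \<le> p" "real p * h \<le> z" "z \<le> real (p + 1) * h"
    and v: "\<And>r. r \<in> {p - 1..p + 2} \<Longrightarrow> \<bar>v r\<bar> \<le> S"
  shows "\<bar>cubic_interp h p v z\<bar> \<le> 32 * S"
proof -
  let ?I = "{p - 1..p + 2}"
  have card: "card ?I = 4" using assms by simp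
  have weight: "\<bar>\<Prod>s\<in>?I - {r}. (z - real s * h) / (real r * h - real s * h)\<bar> \<le> 8" if r: "r \<in> ?I" for r
  proof -
    have "(\<Prod>s\<in>?I - {r}. \<bar>(z - real s * h) / (real r * h - real s * h)\<bar>) \<le> (\<Prod>s\<in>?I - {r}. 2)"
    proof (intro prod_mono conjI)
      fix s assume s: "s \<in> ?I - {r}"
      have "real p - 1 \<le> real s" "real s \<le> real p + 2" using s assms by auto
      then have "(real p - 1) * h \<le> real s * h" "real s * h \<le> (real p + 2) * h"
        using assms by (auto intro!: mult_right_mono)
      then have num: "\<bar>z - real s * h\<bar> \<le> 2 * h" using assms by (auto simp: algebra_simps abs_le_iff)
      have "\<bar>real r - real s\<bar> \<ge> 1" using s by auto
      then have "1 * h \<le> \<bar>real r - real s\<bar> * h" using assms by (intro mult_right_mono) auto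
      then have den: "h \<le> \<bar>real r * h - real s * h\<bar>"
        using assms by (simp add: abs_mult left_diff_distrib[symmetric])
      have "\<bar>z - real s * h\<bar> / \<bar>real r * h - real s * h\<bar> \<le> (2 * h) / h"
        using num den assms by (intro frac_le) auto
      then show "\<bar>(z - real s * h) / (real r * h - real s * h)\<bar> \<le> 2"
        using assms by (simp add: abs_divide)
    qed auto
    also have "\<dots> = 2 ^ 3" using r card by (simp add: card_Diff_singleton)
    finally show ?thesis by (simp add: abs_prod)
  qed
  have "\<bar>cubic_interp h p v z\<bar> \<le>
      (\<Sum>r\<in>?I. \<bar>v r * (\<Prod>s\<in>?I - {r}. (z - real s * h) / (real r * h - real s * h))\<bar>)"
    unfolding cubic_interp_def lagrange_interp_def by (rule sum_abs)
  also have "\<dots> \<le> (\<Sum>r\<in>?I. S * 8)"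
  proof (rule sum_mono)
    fix r assume r: "r \<in> ?I"
    show "\<bar>v r * (\<Prod>s\<in>?I - {r}. (z - real s * h) / (real r * h - real s * h))\<bar> \<le> S * 8"
      unfolding abs_mult using v[OF r] weight[OF r] by (intro mult_mono) auto
  qed
  also have "\<dots> = 32 * S" using card by simp
  finally show ?thesis .
qed

lemma compact_op_bound:
  assumes "\<And>n. n \<in> {i - 1..i + 1} \<Longrightarrow> \<bar>v n\<bar> \<le> S"
  shows "\<bar>compact_op v i\<bar> \<le> S"
proof -
  have "\<bar>v (i + 1)\<bar> \<le> S" "\<bar>v i\<bar> \<le> S" "\<bar>v (i - 1)\<bar> \<le> S" using assms by auto
  then show ?thesis unfolding compact_op_def by (auto simp: abs_le_iff)
qed

section \<open>Discrete Dirichlet form, summation by parts and embeddings\<close>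

text \<open>The polarisation of \<open>norm_bwd_sq\<close>, that is, the discrete Dirichlet
  form.\<close>

definition inner_bwd :: "real \<Rightarrow> nat \<Rightarrow> (nat \<Rightarrow> real) \<Rightarrow> (nat \<Rightarrow> real) \<Rightarrow> real" where
  "inner_bwd h N v w = (\<Sum>i=1..N. diff_bwd h v i * diff_bwd h w i * h)"

lemma inner_bwd_self: "inner_bwd h N v v = norm_bwd_sq h N v"
  by (simp add: inner_bwd_def norm_bwd_sq_def power2_eq_square)

lemma norm_bwd_sq_nonneg: "0 \<le> h \<Longrightarrow> 0 \<le> norm_bwd_sq h N v"
  by (simp add: norm_bwd_sq_def sum_nonneg)

lemma norm0_sq_nonneg: "0 \<le> h \<Longrightarrow> 0 \<le> norm0_sq h N v"
  by (simp add: norm0_sq_def sum_nonneg)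

lemma Cauchy_Schwarz_weighted:
  fixes a b :: "'a \<Rightarrow> real"
  assumes "0 \<le> h"
  shows "\<bar>\<Sum>i\<in>I. a i * b i * h\<bar> \<le> sqrt (\<Sum>i\<in>I. (a i)\<^sup>2 * h) * sqrt (\<Sum>i\<in>I. (b i)\<^sup>2 * h)"
proof -
  have "(\<Sum>i\<in>I. a i * b i)\<^sup>2 \<le> (\<Sum>i\<in>I. (a i)\<^sup>2) * (\<Sum>i\<in>I. (b i)\<^sup>2)"
    by (rule Cauchy_Schwarz_ineq_sum)
  then have "\<bar>\<Sum>i\<in>I. a i * b i\<bar> \<le> sqrt ((\<Sum>i\<in>I. (a i)\<^sup>2) * (\<Sum>i\<in>I. (b i)\<^sup>2))"
    by (metis real_sqrt_abs real_sqrt_le_iff)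
  then have "\<bar>\<Sum>i\<in>I. a i * b i\<bar> * h \<le> sqrt ((\<Sum>i\<in>I. (a i)\<^sup>2) * (\<Sum>i\<in>I. (b i)\<^sup>2)) * h"
    using assms by (rule mult_right_mono)
  moreover have "sqrt h * sqrt h = h" using assms by simp
  ultimately show ?thesis using assms
    unfolding sum_distrib_right[symmetric] real_sqrt_mult abs_mult
    by (simp add: mult.assoc mult.left_commute[of "sqrt h"])
qed

lemma inner_bwd_Cauchy_Schwarz:
  assumes "0 \<le> h"
  shows "\<bar>inner_bwd h N v w\<bar> \<le> sqrt (norm_bwd_sq h N v) * sqrt (norm_bwd_sq h N w)"
  unfolding inner_bwd_def norm_bwd_sq_def using assms by (rule Cauchy_Schwarz_weighted)

text \<open>Boundary values are prescribed for the test function \<open>w\<close> alone; this admits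
  combinations containing \<open>y 0\<close> in the place of \<open>v\<close>.\<close>

lemma summation_by_parts:
  assumes "h \<noteq> 0" "0 < N" "w 0 = 0" "w N = 0"
  shows "(\<Sum>i=1..N-1. diff_xx h v i * w i * h) = - inner_bwd h N v w"
proof -
  \<comment> \<open>The induction over partial sums carries a boundary term at the right end, which
    vanishes once \<open>Suc n\<close> reaches \<open>N\<close>.\<close>
  have *: "(\<Sum>i=1..n. diff_xx h v i * w i * h) =
      - (\<Sum>i=1..Suc n. diff_bwd h v i * diff_bwd h w i * h) + diff_bwd h v (Suc n) * w (Suc n)" for n
  proof (induction n)
    case 0
    then show ?case using assms by (simp add: diff_bwd_def)
  next
    case (Suc n)
    have "diff_xx h v (Suc n) * h = diff_bwd h v (Suc (Suc n)) - diff_bwd h v (Suc n)"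
      and "diff_bwd h w (Suc (Suc n)) * h = w (Suc (Suc n)) - w (Suc n)"
      using \<open>h \<noteq> 0\<close> by (simp_all add: diff_bwd_def diff_xx_def field_simps power2_eq_square)
    then have "diff_xx h v (Suc n) * w (Suc n) * h = - (diff_bwd h v (Suc (Suc n)) * diff_bwd h w (Suc (Suc n)) * h)
        + diff_bwd h v (Suc (Suc n)) * w (Suc (Suc n)) - diff_bwd h v (Suc n) * w (Suc n)"
      by algebra
    with Suc show ?case by simp
  qed
  show ?thesis using *[of "N - 1"] assms by (simp add: inner_bwd_def)
qed

text \<open>The increment telescopes into backward differences, and Cauchy-Schwarz against the
  constant 1 yields the discrete one-dimensional Sobolev embedding.\<close>

lemma grid_increment_bound:
  assumes "0 < h" "i \<le> n" "n \<le> N"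
  shows "\<bar>v n - v i\<bar> \<le> sqrt (real N * h) * sqrt (norm_bwd_sq h N v)"
proof -
  have "v n - v i = (\<Sum>k=i+1..n. 1 * diff_bwd h v k * h)"
    using \<open>i \<le> n\<close>
  proof (induction n rule: dec_induct)
    case base
    then show ?case by simp
  next
    case (step n)
    then show ?case using \<open>0 < h\<close> by (simp add: diff_bwd_def)
  qed
  also have "\<bar>\<dots>\<bar> \<le> sqrt (\<Sum>k=i+1..n. 1\<^sup>2 * h) * sqrt (\<Sum>k=i+1..n. (diff_bwd h v k)\<^sup>2 * h)"
    using assms by (intro Cauchy_Schwarz_weighted) auto
  also have "\<dots> \<le> sqrt (real N * h) * sqrt (norm_bwd_sq h N v)"
    unfolding norm_bwd_sq_def using assms
    by (intro mult_mono real_sqrt_le_mono sum_mono2) (auto intro!: mult_right_mono sum_nonneg)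
  finally show ?thesis .
qed

lemma sup_bound_zero_boundary:
  assumes "0 < h" "v 0 = 0" "n \<le> N"
  shows "\<bar>v n\<bar> \<le> sqrt (real N * h) * sqrt (norm_bwd_sq h N v)"
  using grid_increment_bound[of h 0 n N v] assms by simp

text \<open>Meant for the initial level, which need not vanish at the end points: \<open>v n\<close>
  is compared with every interior value \<open>v i\<close> and the result is averaged over
  \<open>i\<close>, so the norm of the values themselves enters as well.\<close>

lemma sup_bound:
  assumes h: "0 < h" and N: "2 \<le> N" and n: "n \<le> N" and l: "real N * h = l"
  shows "\<bar>v n\<bar> \<le> sqrt (4 / l + 4 * l) * sqrt (norm0_sq h N v + norm_bwd_sq h N v)"
proof -
  let ?E = "norm_bwd_sq h N v"
  have l0: "0 < l" using h N l by auto
  have E: "0 \<le> ?E" using h by (simp add: norm_bwd_sq_nonneg)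
  have diff: "(v n)\<^sup>2 \<le> 2 * (v i)\<^sup>2 + 2 * (l * ?E)" if "i \<le> N" for i
  proof -
    have "\<bar>v n - v i\<bar> \<le> sqrt l * sqrt ?E"
    proof (cases "i \<le> n")
      case True then show ?thesis using grid_increment_bound[of h i n N v] h n l by simp
    next
      case False then show ?thesis
        using grid_increment_bound[of h n i N v] h that l by (simp add: abs_minus_commute)
    qed
    then have "\<bar>v n - v i\<bar>\<^sup>2 \<le> (sqrt l * sqrt ?E)\<^sup>2" by (intro power_mono) auto
    then have 1: "(v n - v i)\<^sup>2 \<le> l * ?E" using l0 E by (simp add: power_mult_distrib)
    have "0 \<le> (v n - 2 * v i)\<^sup>2" by simp
    then have "(v n)\<^sup>2 \<le> 2 * (v i)\<^sup>2 + 2 * (v n - v i)\<^sup>2"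
      by (simp add: power2_eq_square algebra_simps)
    with 1 show ?thesis by linarith
  qed
  \<comment> \<open>The interior nodes carry at least half of the length, as \<open>N - 1\<close> is
    at least \<open>N / 2\<close> for \<open>N\<close> at least 2.\<close>
  have "l / 2 * (v n)\<^sup>2 \<le> (real (N - 1) * h) * (v n)\<^sup>2"
  proof (rule mult_right_mono)
    have "real N / 2 * h \<le> real (N - 1) * h" using N h by (intro mult_right_mono) auto
    then show "l / 2 \<le> real (N - 1) * h" using l by simp
  qed simp
  also have "\<dots> = (\<Sum>i=1..N-1. (v n)\<^sup>2 * h)" by simp
  also have "\<dots> \<le> (\<Sum>i=1..N-1. (2 * (v i)\<^sup>2 + 2 * (l * ?E)) * h)"
    using h by (intro sum_mono mult_right_mono diff) auto
  also have "\<dots> = 2 * norm0_sq h N v + 2 * (l * ?E) * (real (N - 1) * h)"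
    by (simp add: norm0_sq_def sum_distrib_left distrib_right sum.distrib algebra_simps)
  also have "\<dots> \<le> 2 * norm0_sq h N v + 2 * (l * ?E) * l"
    using l0 E h by (intro add_left_mono mult_left_mono) (auto simp: l[symmetric])
  finally have "(v n)\<^sup>2 \<le> (4 / l) * norm0_sq h N v + 4 * l * ?E"
    using l0 by (simp add: field_simps)
  also have "\<dots> \<le> (4 / l + 4 * l) * (norm0_sq h N v + ?E)"
    using l0 E norm0_sq_nonneg[of h N v] h by (simp add: algebra_simps)
  finally show ?thesis
    by (metis real_sqrt_abs real_sqrt_le_iff real_sqrt_mult)
qed


section \<open>Linearity of the difference operators\<close>

lemma diff_xx_lincomb:
  "diff_xx h (\<lambda>i. a * v i + b * w i) i = a * diff_xx h v i + b * diff_xx h w i"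
  unfolding diff_xx_def by (simp add: add_divide_distrib[symmetric] algebra_simps)

lemma diff_xx_sum: "diff_xx h (\<lambda>i. \<Sum>j\<in>A. v j i) i = (\<Sum>j\<in>A. diff_xx h (v j) i)"
  unfolding diff_xx_def
  by (simp add: sum_divide_distrib[symmetric] sum.distrib sum_subtractf sum_distrib_left)

lemma inner_bwd_lincomb:
  "inner_bwd h N (\<lambda>i. a * v i + b * v' i) w = a * inner_bwd h N v w + b * inner_bwd h N v' w"
proof -
  have "diff_bwd h (\<lambda>i. a * v i + b * v' i) i = a * diff_bwd h v i + b * diff_bwd h v' i" for i
    unfolding diff_bwd_def by (simp add: add_divide_distrib[symmetric] algebra_simps)
  then show ?thesis
    by (simp add: inner_bwd_def sum_distrib_left sum.distrib[symmetric] algebra_simps)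
qed

lemma inner_bwd_sum: "inner_bwd h N (\<lambda>i. \<Sum>j\<in>A. v j i) w = (\<Sum>j\<in>A. inner_bwd h N (v j) w)"
proof -
  have "diff_bwd h (\<lambda>i. \<Sum>j\<in>A. v j i) i = (\<Sum>j\<in>A. diff_bwd h (v j) i)" for i
    unfolding diff_bwd_def by (simp add: sum_divide_distrib[symmetric] sum_subtractf)
  then show ?thesis
    unfolding inner_bwd_def by (simp add: sum_distrib_right) (rule sum.swap)
qed

section \<open>Energy inequality for the scheme summed in time\<close>

text \<open>Separates level 0, which is data, from the levels \<open>1, ..., J + 1\<close>, to which
  the Gronwall inequality applies.\<close>

lemma sum_average_le:
  fixes F :: "nat \<Rightarrow> real"
  assumes "\<And>j. 0 \<le> F j"
  shows "(\<Sum>j=0..J. (F (j + 1) + F j) / 2) \<le> F 0 + (\<Sum>s=0..J. F (s + 1))"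
proof -
  have "(\<Sum>j=0..J. (F (j + 1) + F j) / 2) + F (J + 1) / 2 = F 0 / 2 + (\<Sum>s=0..J. F (s + 1))"
    by (induction J) (auto simp: field_simps)
  then show ?thesis using assms[of 0] assms[of "J + 1"] by linarith
qed

text \<open>The maximum-norm bounds \<open>S j\<close> are left abstract because level 0 and the
  later levels are bounded in different ways. \<open>g\<close> stands for the loading term and
  \<open>\<phi>\<close> for the source. Each term on the right keeps a factor
  \<open>E (J + 1)\<close> or \<open>S (J + 1)\<close> from the test function, to be divided out
  afterwards.\<close>

lemma integrated_energy_inequality:
  fixes y :: "nat \<Rightarrow> nat \<Rightarrow> real" and h :: real and N :: nat
  defines "E \<equiv> \<lambda>j. sqrt (norm_bwd_sq h N (y j))"
  assumes \<alpha>: "0 < \<alpha>" "\<alpha> < 1" and "0 < \<mu>" and h: "0 < h" and \<tau>: "0 < \<tau>" and N: "2 \<le> N"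
    and l: "real N * h = l" and T: "real (J + 1) * \<tau> \<le> T"
    and scheme: "\<And>j i. j \<le> J \<Longrightarrow> i \<in> {1..N-1} \<Longrightarrow>
        frac_diff \<alpha> \<tau> (\<lambda>s. compact_op (y s) i) j = diff_xx h (time_avg y j) i
          + \<mu> * ((diff_xx h (y (j + 1)) i - diff_xx h (y j) i) / \<tau>) + g j i + \<phi> j i"
    and bc: "y (J + 1) 0 = 0" "y (J + 1) N = 0"
    and S: "\<And>j i. j \<le> J + 1 \<Longrightarrow> i \<le> N \<Longrightarrow> \<bar>y j i\<bar> \<le> S j"
    and g: "\<And>j i. j \<le> J \<Longrightarrow> i \<in> {1..N-1} \<Longrightarrow> \<bar>g j i\<bar> \<le> Q * ((S (j + 1) + S j) / 2)"
  shows "\<mu> * (E (J + 1))\<^sup>2 \<le>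
    (\<mu> * E 0 + \<tau> * (\<Sum>j=0..J. (E (j + 1) + E j) / 2)) * E (J + 1) +
    S (J + 1) * (l * (\<tau> powr (1 - \<alpha>) / Gamma (2 - \<alpha>) * (\<Sum>s=0..J. frac_coeff \<alpha> (J - s) * S (s + 1))
        + T powr (1 - \<alpha>) / Gamma (2 - \<alpha>) * S 0 + Q * \<tau> * (\<Sum>j=0..J. (S (j + 1) + S j) / 2))
      + sqrt l * (\<tau> * (\<Sum>j=0..J. sqrt (norm0_sq h N (\<phi> j)))))"
proof -
  define w where "w = y (J + 1)"
  define \<kappa> where "\<kappa> = \<tau> powr (1 - \<alpha>) / Gamma (2 - \<alpha>)"
  have Gamma: "0 < Gamma (2 - \<alpha>)" using \<alpha> by (intro Gamma_real_pos) auto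
  have \<kappa>: "0 \<le> \<kappa>" using Gamma by (simp add: \<kappa>_def)
  have S0: "0 \<le> S j" if "j \<le> J + 1" for j using S[OF that, of 0] by linarith
  \<comment> \<open>The summed scheme reads \<open>diff_xx h Z i = R i\<close>: \<open>Z\<close>
    collects what stands under second differences, \<open>R\<close> all the rest. The redundant
    \<open>1 *\<close> and \<open>(- \<mu>) *\<close> give \<open>Z\<close> the shape of a linear
    combination, as the linearity lemmas expect.\<close>
  define Z where "Z = (\<lambda>i. 1 * (\<mu> * y (J + 1) i + (- \<mu>) * y 0 i) + \<tau> * (\<Sum>j=0..J. time_avg y j i))"
  define R where "R i = \<kappa> * ((\<Sum>s=0..J. frac_coeff \<alpha> (J - s) * compact_op (y (s + 1)) i)
      - (real J + 1/2) powr (1 - \<alpha>) * compact_op (y 0) i)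
      - \<tau> * (\<Sum>j=0..J. g j i) - \<tau> * (\<Sum>j=0..J. \<phi> j i)" for i
  have eq: "diff_xx h Z i = R i" if i: "i \<in> {1..N-1}" for i
  proof -
    \<comment> \<open>Multiplying each level by \<open>\<tau>\<close> cancels the quotient in the
      \<open>\<mu>\<close> term, which then telescopes to the last and the initial level.\<close>
    have "(\<Sum>j=0..J. \<tau> * frac_diff \<alpha> \<tau> (\<lambda>s. compact_op (y s) i) j) =
        (\<Sum>j=0..J. \<tau> * diff_xx h (time_avg y j) i + \<mu> * (diff_xx h (y (Suc j)) i - diff_xx h (y j) i)
          + \<tau> * g j i + \<tau> * \<phi> j i)"
      using \<tau> i by (intro sum.cong) (auto simp: scheme field_simps)
    also have "\<dots> = \<tau> * (\<Sum>j=0..J. diff_xx h (time_avg y j) i)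
        + \<mu> * (\<Sum>j=0..J. diff_xx h (y (Suc j)) i - diff_xx h (y j) i)
        + \<tau> * (\<Sum>j=0..J. g j i) + \<tau> * (\<Sum>j=0..J. \<phi> j i)"
      by (simp only: sum.distrib sum_distrib_left)
    also have "(\<Sum>j=0..J. diff_xx h (y (Suc j)) i - diff_xx h (y j) i) = diff_xx h (y (J + 1)) i - diff_xx h (y 0) i"
      by (subst sum_Suc_diff) auto
    finally have "R i = \<tau> * (\<Sum>j=0..J. diff_xx h (time_avg y j) i)
        + \<mu> * (diff_xx h (y (J + 1)) i - diff_xx h (y 0) i)"
      unfolding R_def sum_frac_diff[OF \<tau>] \<kappa>_def[symmetric] by simp
    then show ?thesis
      unfolding Z_def diff_xx_lincomb diff_xx_sum by (simp add: algebra_simps)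
  qed
  have "inner_bwd h N Z w = - (\<Sum>i=1..N-1. R i * w i * h)"
    using summation_by_parts[of h N w Z] h N bc eq by (simp add: w_def)
  moreover have "inner_bwd h N Z w = \<mu> * (E (J + 1))\<^sup>2 - \<mu> * inner_bwd h N (y 0) w
      + \<tau> * (\<Sum>j=0..J. inner_bwd h N (time_avg y j) w)"
    using h unfolding Z_def inner_bwd_lincomb inner_bwd_sum
    by (simp add: w_def E_def inner_bwd_self norm_bwd_sq_nonneg)
  moreover have "\<mu> * inner_bwd h N (y 0) w \<le> \<mu> * (E 0 * E (J + 1))"
    using inner_bwd_Cauchy_Schwarz[of h N "y 0" w] h \<open>0 < \<mu>\<close> by (simp add: E_def w_def)
  \<comment> \<open>Tested with the last level only, the averages have no definite sign;
    Cauchy-Schwarz suffices, as the factor \<open>\<tau>\<close> makes this a term for the Gronwall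
    inequality.\<close>
  moreover have "\<tau> * (\<Sum>j=0..J. - inner_bwd h N (time_avg y j) w) \<le>
      \<tau> * (\<Sum>j=0..J. (E (j + 1) + E j) / 2 * E (J + 1))"
  proof (intro mult_left_mono sum_mono)
    fix j
    have avg: "time_avg y j = (\<lambda>i. 1/2 * y (j + 1) i + 1/2 * y j i)"
      by (auto simp: time_avg_def)
    have "- inner_bwd h N (y (j + 1)) w \<le> E (j + 1) * E (J + 1)" "- inner_bwd h N (y j) w \<le> E j * E (J + 1)"
      using inner_bwd_Cauchy_Schwarz[of h N "y (j + 1)" w] inner_bwd_Cauchy_Schwarz[of h N "y j" w] h
      by (auto simp: E_def w_def)
    then show "- inner_bwd h N (time_avg y j) w \<le> (E (j + 1) + E j) / 2 * E (J + 1)"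
      unfolding avg inner_bwd_lincomb by (simp add: distrib_right add_divide_distrib)
  qed (use \<tau> in auto)
  then have "- (\<tau> * (\<Sum>j=0..J. inner_bwd h N (time_avg y j) w)) \<le>
      \<tau> * (\<Sum>j=0..J. (E (j + 1) + E j) / 2) * E (J + 1)"
    by (simp only: sum_negf sum_distrib_right[symmetric] mult_minus_right mult.assoc)
  \<comment> \<open>\<open>C\<close> is the part of the bound for \<open>R i\<close> that is uniform
    in \<open>i\<close>; the source is kept apart, since only its mean-square norm is
    available.\<close>
  moreover define C where "C = \<kappa> * (\<Sum>s=0..J. frac_coeff \<alpha> (J - s) * S (s + 1))
        + T powr (1 - \<alpha>) / Gamma (2 - \<alpha>) * S 0 + Q * \<tau> * (\<Sum>j=0..J. (S (j + 1) + S j) / 2)"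
  have "- (\<Sum>i=1..N-1. R i * w i * h) \<le>
      S (J + 1) * (l * C + sqrt l * (\<tau> * (\<Sum>j=0..J. sqrt (norm0_sq h N (\<phi> j)))))"
  proof -
    have Rb: "\<bar>R i\<bar> \<le> C + \<tau> * (\<Sum>j=0..J. \<bar>\<phi> j i\<bar>)" and C: "0 \<le> C" if i: "i \<in> {1..N-1}" for i
    proof -
      have H: "\<bar>compact_op (y s) i\<bar> \<le> S s" if "s \<le> J + 1" for s
        using i that by (intro compact_op_bound S) auto
      have "\<bar>\<Sum>s=0..J. frac_coeff \<alpha> (J - s) * compact_op (y (s + 1)) i\<bar> \<le>
          (\<Sum>s=0..J. frac_coeff \<alpha> (J - s) * S (s + 1))"
        using H frac_coeff_nonneg[OF \<alpha>(2)]
        by (intro order_trans[OF sum_abs] sum_mono) (auto simp: abs_mult intro!: mult_left_mono)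
      then have 1: "\<bar>\<kappa> * (\<Sum>s=0..J. frac_coeff \<alpha> (J - s) * compact_op (y (s + 1)) i)\<bar> \<le>
          \<kappa> * (\<Sum>s=0..J. frac_coeff \<alpha> (J - s) * S (s + 1))"
        using \<kappa> by (simp add: abs_mult mult_left_mono)
      \<comment> \<open>The initial value has the coefficient
        \<open>(\<tau> * (J + 1/2)) powr (1 - \<alpha>)\<close> up to the Gamma factor, which the
        final time bounds independently of \<open>\<tau>\<close>.\<close>
      have "\<tau> * (real J + 1/2) \<le> T" using T \<tau> by (simp add: algebra_simps)
      then have "(\<tau> * (real J + 1/2)) powr (1 - \<alpha>) \<le> T powr (1 - \<alpha>)"
        using \<tau> \<alpha> by (intro powr_mono2) auto
      then have "\<kappa> * (real J + 1/2) powr (1 - \<alpha>) \<le> T powr (1 - \<alpha>) / Gamma (2 - \<alpha>)"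
        using \<tau> Gamma by (simp add: \<kappa>_def powr_mult divide_right_mono)
      then have "(\<kappa> * (real J + 1/2) powr (1 - \<alpha>)) * \<bar>compact_op (y 0) i\<bar> \<le>
          T powr (1 - \<alpha>) / Gamma (2 - \<alpha>) * S 0"
        using H[of 0] Gamma by (intro mult_mono) auto
      then have 2: "\<bar>\<kappa> * ((real J + 1/2) powr (1 - \<alpha>) * compact_op (y 0) i)\<bar> \<le>
          T powr (1 - \<alpha>) / Gamma (2 - \<alpha>) * S 0"
        using \<kappa> by (simp add: abs_mult mult.assoc)
      have "\<bar>\<Sum>j=0..J. g j i\<bar> \<le> (\<Sum>j=0..J. Q * ((S (j + 1) + S j) / 2))"
        using i by (intro order_trans[OF sum_abs] sum_mono g) auto
      then have "\<tau> * \<bar>\<Sum>j=0..J. g j i\<bar> \<le> \<tau> * (\<Sum>j=0..J. Q * ((S (j + 1) + S j) / 2))"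
        using \<tau> by (intro mult_left_mono) auto
      then have 3: "\<bar>\<tau> * (\<Sum>j=0..J. g j i)\<bar> \<le> Q * \<tau> * (\<Sum>j=0..J. (S (j + 1) + S j) / 2)"
        using \<tau> by (simp only: abs_mult sum_distrib_left[symmetric]) (simp add: mult_ac)
      have 4: "\<bar>\<tau> * (\<Sum>j=0..J. \<phi> j i)\<bar> \<le> \<tau> * (\<Sum>j=0..J. \<bar>\<phi> j i\<bar>)"
        using \<tau> by (simp add: abs_mult mult_left_mono sum_abs)
      show "\<bar>R i\<bar> \<le> C + \<tau> * (\<Sum>j=0..J. \<bar>\<phi> j i\<bar>)"
        using 1 2 3 4 unfolding R_def C_def right_diff_distrib by linarith
      show "0 \<le> C"
        using 1 2 3 unfolding C_def by linarith
    qed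
    have "- (\<Sum>i=1..N-1. R i * w i * h) \<le> (\<Sum>i=1..N-1. S (J + 1) * ((C + \<tau> * (\<Sum>j=0..J. \<bar>\<phi> j i\<bar>)) * h))"
      unfolding sum_negf[symmetric]
    proof (rule sum_mono)
      fix i assume i: "i \<in> {1..N-1}"
      have "- (R i * w i) \<le> \<bar>R i\<bar> * \<bar>w i\<bar>" by (simp add: abs_mult[symmetric])
      also have "\<dots> \<le> (C + \<tau> * (\<Sum>j=0..J. \<bar>\<phi> j i\<bar>)) * S (J + 1)"
        using i Rb[OF i] S[of "J + 1" i] by (intro mult_mono) (auto simp: w_def)
      finally have "- (R i * w i) * h \<le> (C + \<tau> * (\<Sum>j=0..J. \<bar>\<phi> j i\<bar>)) * S (J + 1) * h"
        using h by (intro mult_right_mono) auto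
      then show "- (R i * w i * h) \<le> S (J + 1) * ((C + \<tau> * (\<Sum>j=0..J. \<bar>\<phi> j i\<bar>)) * h)"
        by (simp add: mult_ac)
    qed
    also have "\<dots> = S (J + 1) * ((\<Sum>i=1..N-1. C * h) + (\<Sum>i=1..N-1. \<tau> * (\<Sum>j=0..J. \<bar>\<phi> j i\<bar> * h)))"
      by (simp only: sum_distrib_left[symmetric] distrib_right sum.distrib mult.assoc
          sum_distrib_right[symmetric])
    also have "(\<Sum>i=1..N-1. \<tau> * (\<Sum>j=0..J. \<bar>\<phi> j i\<bar> * h)) = \<tau> * (\<Sum>j=0..J. \<Sum>i=1..N-1. \<bar>\<phi> j i\<bar> * h)"
      unfolding sum_distrib_left[symmetric] by (subst sum.swap) simp
    also have "S (J + 1) * ((\<Sum>i=1..N-1. C * h) + \<dots>) \<le>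
        S (J + 1) * (l * C + \<tau> * (\<Sum>j=0..J. sqrt l * sqrt (norm0_sq h N (\<phi> j))))"
    proof (intro mult_left_mono add_mono sum_mono)
      have lN: "real (N - 1) * h \<le> l"
        unfolding l[symmetric] using h by (intro mult_right_mono) auto
      have l0: "0 \<le> l" unfolding l[symmetric] using h by simp
      show "(\<Sum>i=1..N-1. C * h) \<le> l * C"
      proof -
        \<comment> \<open>Nonnegativity of \<open>C\<close> was read off from the bounds at an
          interior node; node 1 is one.\<close>
        have "0 \<le> C" using N by (intro C[of 1]) auto
        then show ?thesis using mult_right_mono[OF lN, of C] by (simp add: mult_ac)
      qed
      fix j
      \<comment> \<open>Cauchy-Schwarz against 1 trades the discrete L1 norm of the source for
        \<open>sqrt l\<close> times its mean-square norm.\<close>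
      have "(\<Sum>i=1..N-1. \<bar>\<phi> j i\<bar> * h) \<le> \<bar>\<Sum>i=1..N-1. 1 * \<bar>\<phi> j i\<bar> * h\<bar>" by simp
      also have "\<dots> \<le> sqrt (\<Sum>i=1..N-1. 1\<^sup>2 * h) * sqrt (\<Sum>i=1..N-1. \<bar>\<phi> j i\<bar>\<^sup>2 * h)"
        using h by (intro Cauchy_Schwarz_weighted) auto
      also have "\<dots> \<le> sqrt l * sqrt (norm0_sq h N (\<phi> j))"
        using lN l0 h by (intro mult_mono real_sqrt_le_mono) (auto simp: norm0_sq_def sum_nonneg)
      finally show "(\<Sum>i=1..N-1. \<bar>\<phi> j i\<bar> * h) \<le> sqrt l * sqrt (norm0_sq h N (\<phi> j))" .
    qed (use S0[of "J + 1"] \<tau> in auto)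
    finally show ?thesis
      by (simp add: sum_distrib_left[symmetric] mult_ac)
  qed
  ultimately show ?thesis
    unfolding C_def \<kappa>_def distrib_right[of _ _ "E (J + 1)"] mult.assoc[of \<mu>] by linarith
qed

section \<open>The a priori estimate\<close>

theorem theorem2:
  fixes \<alpha> \<mu> l T c1 :: real and m :: nat and xl :: "nat \<Rightarrow> real"
  assumes "0 < \<alpha>" and "\<alpha> < 1" and "0 < \<mu>" and "0 < T"
    and "1 \<le> m"
    and "0 < xl 1" and "strict_mono_on {1..m} xl" and "xl m < l"
  shows "\<exists>\<tau>0>0. \<exists>MT>0.
    \<forall>(q :: nat \<Rightarrow> real \<Rightarrow> real \<Rightarrow> real) (f :: real \<Rightarrow> real \<Rightarrow> real) (u0 :: real \<Rightarrow> real)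
     (N :: nat) (M :: nat) (h :: real) (\<tau> :: real) (p :: nat \<Rightarrow> nat) (y :: nat \<Rightarrow> nat \<Rightarrow> real).
      (\<forall>k\<in>{1..m}. \<forall>x\<in>{0..l}. \<forall>t\<in>{0<..T}. \<bar>q k x t\<bar> < c1) \<longrightarrow>
      0 < N \<longrightarrow> 0 < M \<longrightarrow> h = l / real N \<longrightarrow> \<tau> = T / real M \<longrightarrow>
      h < min (xl 1) (l - xl m) \<longrightarrow> \<tau> \<le> \<tau>0 \<longrightarrow>
      loading_indices h m xl p \<longrightarrow>
      solves_scheme \<alpha> \<mu> h \<tau> N M m xl p q f u0 y \<longrightarrow>
      (\<forall>j<M. norm_bwd_sq h N (y (j + 1)) \<le>
         MT * ((\<Sum>j'=0..j. norm0_sq h N (compact_op (\<lambda>i. f (real i * h) (t_mid \<tau> j'))) * \<tau>)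
               + norm0_sq h N (y 0) + norm_bwd_sq h N (y 0)))"
proof -
  have xl: "xl 1 \<le> xl k" "xl k \<le> xl m" if "k \<in> {1..m}" for k
    using strict_mono_on_leD[OF assms(7), of 1 k] strict_mono_on_leD[OF assms(7), of k m] that
    by auto
  have l: "0 < l" using xl(1)[of m] assms by auto
  have Gamma: "0 < Gamma (2 - \<alpha>)" using assms by (intro Gamma_real_pos) auto
  \<comment> \<open>There are \<open>m\<close> loading terms, each with a coefficient bounded by
    \<open>\<bar>c1\<bar>\<close> and the interpolation constant 32.\<close>
  define Q where "Q = real m * (\<bar>c1\<bar> * 32)"
  define c where "c = sqrt (4 / l + 4 * l)"
  \<comment> \<open>\<open>A\<close> and \<open>B\<close> are the kernel constants after division by
    \<open>\<mu>\<close>. The factor \<open>l\<^sup>2\<close> is made of \<open>sqrt l\<close> from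
    the test function, \<open>sqrt l\<close> from the solution and \<open>l\<close> from summing
    over the nodes.\<close>
  define A where "A = l\<^sup>2 / Gamma (2 - \<alpha>) / \<mu>"
  define B where "B = (1 + l\<^sup>2 * Q) / \<mu>"
  \<comment> \<open>\<open>G\<close> gathers all multiples of the data: the initial energy from the
    \<open>\<mu>\<close> term and from the averages, the initial value in the fractional derivative
    and in the loading, and the source.\<close>
  define G where "G = (\<mu> + T + sqrt l * (l * (T powr (1 - \<alpha>) / Gamma (2 - \<alpha>) * c + Q * T * c)
    + sqrt l * sqrt T)) / \<mu>"
  have nonneg: "0 \<le> Q" "0 \<le> c" "0 \<le> A" "0 \<le> B" "0 < G"
  proof -
    show Q: "0 \<le> Q" and c: "0 \<le> c" using l by (auto simp: Q_def c_def)
    show "0 \<le> A" "0 \<le> B" using Q Gamma assms by (auto simp: A_def B_def)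
    show "0 < G" unfolding G_def using Q c l Gamma assms by (intro divide_pos_pos add_pos_nonneg) auto
  qed
  obtain \<tau>0 K where "0 < \<tau>0" "0 < K" and gronwall:
    "\<forall>(E :: nat \<Rightarrow> real) D \<tau> J.
      0 < \<tau> \<longrightarrow> \<tau> \<le> \<tau>0 \<longrightarrow> real (Suc J) * \<tau> \<le> T \<longrightarrow> (\<forall>n. 0 \<le> E n) \<longrightarrow> 0 \<le> D \<longrightarrow>
      (\<forall>n\<le>J. E n \<le> D + (\<Sum>s=0..n. (B * \<tau> + A * \<tau> powr (1 - \<alpha>) * frac_coeff \<alpha> (n - s)) * E s)) \<longrightarrow>
      E J \<le> K * D"
    using weakly_singular_gronwall[OF nonneg(3) nonneg(4) assms(4) assms(2)] by blast
  show ?thesis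
  \<comment> \<open>The Gronwall inequality will give \<open>E (J + 1) \<le> K * (G * D)\<close>;
    the constant is the square of \<open>K * G\<close>.\<close>
  proof (rule exI[of _ \<tau>0], rule conjI[OF \<open>0 < \<tau>0\<close>], rule exI[of _ "(K * G)\<^sup>2"], intro conjI allI impI)
    show "0 < (K * G)\<^sup>2" using \<open>0 < K\<close> nonneg by simp
  next
    fix q :: "nat \<Rightarrow> real \<Rightarrow> real \<Rightarrow> real" and f :: "real \<Rightarrow> real \<Rightarrow> real" and u0 :: "real \<Rightarrow> real"
      and N M :: nat and h \<tau> :: real and p :: "nat \<Rightarrow> nat" and y :: "nat \<Rightarrow> nat \<Rightarrow> real" and J :: nat
    assume q: "\<forall>k\<in>{1..m}. \<forall>x\<in>{0..l}. \<forall>t\<in>{0<..T}. \<bar>q k x t\<bar> < c1"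
      and N: "0 < N" and M: "0 < M" and h: "h = l / real N" and \<tau>: "\<tau> = T / real M"
      and hmin: "h < min (xl 1) (l - xl m)" and "\<tau> \<le> \<tau>0"
      and p: "loading_indices h m xl p" and scheme: "solves_scheme \<alpha> \<mu> h \<tau> N M m xl p q f u0 y"
      and J: "J < M"
    have h0: "0 < h" and Nh: "real N * h = l" using h l N by auto
    have \<tau>0: "0 < \<tau>" and M\<tau>: "real M * \<tau> = T" using \<tau> M assms by auto
    \<comment> \<open>As \<open>h\<close> is below the first loading point, which is below
      \<open>l\<close>, there is at least one interior node.\<close>
    have "1 * h < real N * h" using hmin xl(1)[of m] assms(5,8) Nh by auto
    then have N2: "2 \<le> N" using h0 by (simp only: mult_less_cancel_right) auto
    have time: "real (n + 1) * \<tau> \<le> T" if "n < M" for n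
      unfolding M\<tau>[symmetric] using that \<tau>0 by (intro mult_right_mono) auto
    have p1: "1 \<le> p k" and pN: "p k + 2 \<le> N" if k: "k \<in> {1..m}" for k
    proof -
      have pk: "real (p k) * h \<le> xl k" "xl k \<le> real (p k + 1) * h"
        using p k unfolding loading_indices_def by blast+
      \<comment> \<open>The distance of the loading points from both ends exceeds \<open>h\<close>,
        so the stencil \<open>p k - 1, ..., p k + 2\<close> stays in \<open>0, ..., N\<close> and
        the truncated subtraction is harmless.\<close>
      have "1 * h < real (p k + 1) * h" using pk xl(1)[OF k] hmin by auto
      then show "1 \<le> p k" using h0 by (simp only: mult_less_cancel_right) auto
      have "real (p k + 1) * h < real N * h" using pk xl(2)[OF k] hmin Nh by (auto simp: algebra_simps)
      then show "p k + 2 \<le> N" using h0 by (simp only: mult_less_cancel_right) auto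
    qed
    define \<phi> where "\<phi> j = compact_op (\<lambda>i. f (real i * h) (t_mid \<tau> j))" for j
    \<comment> \<open>\<open>D\<close> contains the source up to the final level \<open>J\<close>,
      so one number serves for all levels \<open>n \<le> J\<close> in the Gronwall argument.\<close>
    define D where "D = sqrt ((\<Sum>j'=0..J. norm0_sq h N (\<phi> j') * \<tau>) + norm0_sq h N (y 0) + norm_bwd_sq h N (y 0))"
    define E where "E j = sqrt (norm_bwd_sq h N (y j))" for j
    \<comment> \<open>Later levels vanish at the boundary and are controlled by their energy alone;
      level 0 needs the general embedding with constant \<open>c\<close>.\<close>
    define S where "S j = (if j = 0 then c * D else sqrt l * E j)" for j
    have sum\<phi>: "0 \<le> (\<Sum>j'=0..J. norm0_sq h N (\<phi> j') * \<tau>)"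
      using h0 \<tau>0 by (intro sum_nonneg mult_nonneg_nonneg norm0_sq_nonneg) auto
    have norms: "0 \<le> norm0_sq h N (y 0)" "0 \<le> norm_bwd_sq h N (y j)" for j
      using h0 by (auto intro: norm0_sq_nonneg norm_bwd_sq_nonneg)
    have D: "0 \<le> D" and E: "0 \<le> E j" for j
      using sum\<phi> norms by (auto simp: D_def E_def)
    have E0: "E 0 \<le> D" unfolding E_def D_def using sum\<phi> norms by (intro real_sqrt_le_mono) auto
    have bc: "y (j + 1) 0 = 0" "y (j + 1) N = 0" if "j < M" for j
      using scheme that unfolding solves_scheme_def by auto
    have S: "\<bar>y j i\<bar> \<le> S j" if "j \<le> M" "i \<le> N" for j i
    proof (cases j)
      case 0
      have "\<bar>y 0 i\<bar> \<le> c * sqrt (norm0_sq h N (y 0) + norm_bwd_sq h N (y 0))"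
        unfolding c_def using h0 N2 Nh that by (intro sup_bound) auto
      also have "\<dots> \<le> c * D"
        unfolding D_def using nonneg sum\<phi> by (intro mult_left_mono real_sqrt_le_mono) auto
      finally show ?thesis using 0 by (simp add: S_def)
    next
      case (Suc j')
      then show ?thesis
        using sup_bound_zero_boundary[of h "y j" i N] h0 bc[of j'] that Nh by (auto simp: S_def E_def)
    qed
    define g where "g j = compact_op (\<lambda>n. \<Sum>k=1..m. q k (real n * h) (t_mid \<tau> j) *
                                    cubic_interp h (p k) (time_avg y j) (xl k))" for j
    have g: "\<bar>g j i\<bar> \<le> Q * ((S (j + 1) + S j) / 2)" if j: "j < M" and i: "i \<in> {1..N-1}" for j i
      unfolding g_def
    proof (rule compact_op_bound)
      fix n assume "n \<in> {i - 1..i + 1}"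
      then have "real n * h \<le> real N * h" using i h0 by (intro mult_right_mono) auto
      then have x: "real n * h \<in> {0..l}" using h0 Nh by auto
      have "t_mid \<tau> j \<le> real (j + 1) * \<tau>" unfolding t_mid_def using \<tau>0 by (intro mult_right_mono) auto
      moreover have "0 < t_mid \<tau> j" unfolding t_mid_def using \<tau>0 by (intro mult_pos_pos) auto
      ultimately have t: "t_mid \<tau> j \<in> {0<..T}" using time[OF j] by simp
      have "\<bar>\<Sum>k=1..m. q k (real n * h) (t_mid \<tau> j) * cubic_interp h (p k) (time_avg y j) (xl k)\<bar> \<le>
          (\<Sum>k=1..m. \<bar>c1\<bar> * (32 * ((S (j + 1) + S j) / 2)))"
      proof (intro order_trans[OF sum_abs] sum_mono)
        fix k assume k: "k \<in> {1..m}"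
        have "\<bar>cubic_interp h (p k) (time_avg y j) (xl k)\<bar> \<le> 32 * ((S (j + 1) + S j) / 2)"
        proof (rule cubic_interp_bound)
          show "real (p k) * h \<le> xl k" "xl k \<le> real (p k + 1) * h"
            using p k unfolding loading_indices_def by blast+
          fix r assume "r \<in> {p k - 1..p k + 2}"
          then have "\<bar>y (j + 1) r\<bar> \<le> S (j + 1)" "\<bar>y j r\<bar> \<le> S j"
            using S[of "j + 1" r] S[of j r] pN[OF k] j by auto
          then show "\<bar>time_avg y j r\<bar> \<le> (S (j + 1) + S j) / 2"
            unfolding time_avg_def by (auto simp: abs_le_iff)
        qed (use h0 p1[OF k] in auto)
        moreover have "\<bar>q k (real n * h) (t_mid \<tau> j)\<bar> \<le> \<bar>c1\<bar>" using q k x t by force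
        ultimately show "\<bar>q k (real n * h) (t_mid \<tau> j) * cubic_interp h (p k) (time_avg y j) (xl k)\<bar> \<le>
            \<bar>c1\<bar> * (32 * ((S (j + 1) + S j) / 2))"
          unfolding abs_mult by (intro mult_mono) auto
      qed
      also have "\<dots> = Q * ((S (j + 1) + S j) / 2)" by (simp add: Q_def)
      finally show "\<bar>\<Sum>k=1..m. q k (real n * h) (t_mid \<tau> j) * cubic_interp h (p k) (time_avg y j) (xl k)\<bar> \<le>
          Q * ((S (j + 1) + S j) / 2)" .
    qed
    have step: "E (n + 1) \<le> G * D +
        (\<Sum>s=0..n. (B * \<tau> + A * \<tau> powr (1 - \<alpha>) * frac_coeff \<alpha> (n - s)) * E (s + 1))" if n: "n \<le> J" for n
    proof -
      define \<Sigma> where "\<Sigma> = (\<Sum>s=0..n. E (s + 1))"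
      define \<Lambda> where "\<Lambda> = (\<Sum>s=0..n. frac_coeff \<alpha> (n - s) * E (s + 1))"
      \<comment> \<open>As \<open>n + 1\<close> is not 0, \<open>S (n + 1)\<close> is
        \<open>sqrt l * E (n + 1)\<close>, so the whole right side of the energy inequality is
        \<open>X\<close> times \<open>E (n + 1)\<close>.\<close>
      define X where "X = \<mu> * E 0 + \<tau> * (\<Sum>j=0..n. (E (j + 1) + E j) / 2) +
        sqrt l * (l * (\<tau> powr (1 - \<alpha>) / Gamma (2 - \<alpha>) * (\<Sum>s=0..n. frac_coeff \<alpha> (n - s) * S (s + 1))
          + T powr (1 - \<alpha>) / Gamma (2 - \<alpha>) * S 0 + Q * \<tau> * (\<Sum>j=0..n. (S (j + 1) + S j) / 2))
        + sqrt l * (\<tau> * (\<Sum>j=0..n. sqrt (norm0_sq h N (\<phi> j)))))"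
      have S_nonneg: "0 \<le> S j" for j using D E nonneg l by (simp add: S_def)
      have \<tau>T: "\<tau> \<le> T" using time[of 0] M by simp
      have "\<mu> * (E (n + 1))\<^sup>2 \<le> X * E (n + 1)"
      proof -
        have "\<mu> * (E (n + 1))\<^sup>2 \<le>
          (\<mu> * E 0 + \<tau> * (\<Sum>j=0..n. (E (j + 1) + E j) / 2)) * E (n + 1) +
          S (n + 1) * (l * (\<tau> powr (1 - \<alpha>) / Gamma (2 - \<alpha>) * (\<Sum>s=0..n. frac_coeff \<alpha> (n - s) * S (s + 1))
              + T powr (1 - \<alpha>) / Gamma (2 - \<alpha>) * S 0 + Q * \<tau> * (\<Sum>j=0..n. (S (j + 1) + S j) / 2))
            + sqrt l * (\<tau> * (\<Sum>j=0..n. sqrt (norm0_sq h N (\<phi> j)))))"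
          unfolding E_def
        proof (rule integrated_energy_inequality[where g = g])
          fix j i assume "j \<le> n" "i \<in> {1..N-1}"
          then show "frac_diff \<alpha> \<tau> (\<lambda>s. compact_op (y s) i) j = diff_xx h (time_avg y j) i
              + \<mu> * ((diff_xx h (y (j + 1)) i - diff_xx h (y j) i) / \<tau>) + g j i + \<phi> j i"
            using scheme n J unfolding solves_scheme_def g_def \<phi>_def by auto
        qed (use assms h0 \<tau>0 N2 Nh n J time[of n] bc[of n] S g in auto)
        then show ?thesis by (simp add: X_def S_def algebra_simps)
      qed
      moreover have "X \<le> \<mu> * (G * D + B * \<tau> * \<Sigma> + A * \<tau> powr (1 - \<alpha>) * \<Lambda>)"
      proof -
        have 1: "\<tau> * (\<Sum>j=0..n. (E (j + 1) + E j) / 2) \<le> T * D + \<tau> * \<Sigma>"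
        proof -
          have "\<tau> * (\<Sum>j=0..n. (E (j + 1) + E j) / 2) \<le> \<tau> * (E 0 + \<Sigma>)"
            unfolding \<Sigma>_def using \<tau>0 E by (intro mult_left_mono sum_average_le) auto
          moreover have "\<tau> * E 0 \<le> T * D" using \<tau>0 \<tau>T E0 E by (intro mult_mono) auto
          ultimately show ?thesis by (simp add: distrib_left)
        qed
        have 2: "(\<Sum>s=0..n. frac_coeff \<alpha> (n - s) * S (s + 1)) = sqrt l * \<Lambda>"
          by (simp add: S_def \<Lambda>_def sum_distrib_left mult_ac)
        have 3: "Q * \<tau> * (\<Sum>j=0..n. (S (j + 1) + S j) / 2) \<le> Q * T * c * D + Q * \<tau> * (sqrt l * \<Sigma>)"
        proof -
          have "Q * \<tau> * (\<Sum>j=0..n. (S (j + 1) + S j) / 2) \<le> Q * \<tau> * (S 0 + (\<Sum>s=0..n. S (s + 1)))"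
            using \<tau>0 S_nonneg nonneg by (intro mult_left_mono sum_average_le) auto
          also have "(\<Sum>s=0..n. S (s + 1)) = sqrt l * \<Sigma>"
            by (simp add: S_def \<Sigma>_def sum_distrib_left)
          finally have "Q * \<tau> * (\<Sum>j=0..n. (S (j + 1) + S j) / 2) \<le> Q * \<tau> * S 0 + Q * \<tau> * (sqrt l * \<Sigma>)"
            by (simp add: distrib_left)
          moreover have "Q * \<tau> * S 0 \<le> Q * T * S 0"
            using nonneg \<tau>T S_nonneg by (intro mult_right_mono mult_left_mono) auto
          ultimately show ?thesis by (simp add: S_def mult.assoc)
        qed
        \<comment> \<open>Cauchy-Schwarz again, now in time, with total weight at most
          \<open>T\<close>.\<close>
        have 4: "\<tau> * (\<Sum>j=0..n. sqrt (norm0_sq h N (\<phi> j))) \<le> sqrt T * D"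
        proof -
          have "\<tau> * (\<Sum>j=0..n. sqrt (norm0_sq h N (\<phi> j))) \<le> \<bar>\<Sum>j=0..n. 1 * sqrt (norm0_sq h N (\<phi> j)) * \<tau>\<bar>"
            by (simp add: sum_distrib_left mult.commute)
          also have "\<dots> \<le> sqrt (\<Sum>j=0..n. 1\<^sup>2 * \<tau>) * sqrt (\<Sum>j=0..n. (sqrt (norm0_sq h N (\<phi> j)))\<^sup>2 * \<tau>)"
            using \<tau>0 by (intro Cauchy_Schwarz_weighted) auto
          also have "(\<Sum>j=0..n. (sqrt (norm0_sq h N (\<phi> j)))\<^sup>2 * \<tau>) = (\<Sum>j=0..n. norm0_sq h N (\<phi> j) * \<tau>)"
            using h0 by (simp add: norm0_sq_nonneg)
          also have "sqrt (\<Sum>j=0..n. 1\<^sup>2 * \<tau>) * sqrt (\<Sum>j=0..n. norm0_sq h N (\<phi> j) * \<tau>) \<le> sqrt T * D"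
          proof (intro mult_mono)
            show "sqrt (\<Sum>j=0..n. 1\<^sup>2 * \<tau>) \<le> sqrt T" using time[of n] n J by simp
            have "(\<Sum>j=0..n. norm0_sq h N (\<phi> j) * \<tau>) \<le> (\<Sum>j=0..J. norm0_sq h N (\<phi> j) * \<tau>)"
              using n h0 \<tau>0 by (intro sum_mono2) (auto intro!: mult_nonneg_nonneg norm0_sq_nonneg)
            then show "sqrt (\<Sum>j=0..n. norm0_sq h N (\<phi> j) * \<tau>) \<le> D"
              unfolding D_def using norms by (intro real_sqrt_le_mono) (simp add: add_increasing2)
          qed (use assms \<tau>0 h0 in \<open>auto intro!: sum_nonneg mult_nonneg_nonneg norm0_sq_nonneg\<close>)
          finally show ?thesis .
        qed
        have "X \<le> \<mu> * D + (T * D + \<tau> * \<Sigma>) +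
          sqrt l * (l * (\<tau> powr (1 - \<alpha>) / Gamma (2 - \<alpha>) * (sqrt l * \<Lambda>)
            + T powr (1 - \<alpha>) / Gamma (2 - \<alpha>) * (c * D) + (Q * T * c * D + Q * \<tau> * (sqrt l * \<Sigma>)))
          + sqrt l * (sqrt T * D))"
          unfolding X_def 2 using 1 3 4 E0 l assms
          by (intro add_mono mult_left_mono) (auto simp: S_def)
        also have "\<dots> = (\<mu> + T + sqrt l * (l * (T powr (1 - \<alpha>) / Gamma (2 - \<alpha>) * c + Q * T * c)
            + sqrt l * sqrt T)) * D + (1 + (sqrt l * sqrt l) * l * Q) * \<tau> * \<Sigma>
            + (sqrt l * sqrt l) * l / Gamma (2 - \<alpha>) * \<tau> powr (1 - \<alpha>) * \<Lambda>"
          by (simp add: divide_inverse algebra_simps)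
        also have "\<dots> = \<mu> * (G * D + B * \<tau> * \<Sigma> + A * \<tau> powr (1 - \<alpha>) * \<Lambda>)"
          using l assms by (simp add: G_def B_def A_def power2_eq_square distrib_left)
        finally show ?thesis .
      qed
      moreover have "0 \<le> \<Sigma>" "0 \<le> \<Lambda>"
        using E frac_coeff_nonneg[OF assms(2)] by (auto simp: \<Sigma>_def \<Lambda>_def intro!: sum_nonneg)
      \<comment> \<open>Division by \<open>E (n + 1)\<close> is possible unless it is 0, and then
        the claim holds because the right side is nonnegative.\<close>
      ultimately have "E (n + 1) \<le> G * D + B * \<tau> * \<Sigma> + A * \<tau> powr (1 - \<alpha>) * \<Lambda>"
      proof (cases "E (n + 1) = 0")
        case True
        then show ?thesis using \<open>0 \<le> \<Sigma>\<close> \<open>0 \<le> \<Lambda>\<close> nonneg D \<tau>0 by simp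
      next
        case False
        then have "0 < E (n + 1)" using E[of "n + 1"] by simp
        then have "\<mu> * E (n + 1) \<le> X"
          using \<open>\<mu> * (E (n + 1))\<^sup>2 \<le> X * E (n + 1)\<close> by (simp add: power2_eq_square)
        also note \<open>X \<le> \<mu> * (G * D + B * \<tau> * \<Sigma> + A * \<tau> powr (1 - \<alpha>) * \<Lambda>)\<close>
        finally show ?thesis using assms(3) by simp
      qed
      then show ?thesis
        by (simp add: \<Sigma>_def \<Lambda>_def distrib_right sum.distrib sum_distrib_left mult.assoc)
    qed
    \<comment> \<open>The inequality is applied to the sequence shifted by one level, since level 0
      has been absorbed into \<open>G * D\<close>.\<close>
    have "E (J + 1) \<le> K * (G * D)"
      using gronwall[rule_format, of \<tau> J "\<lambda>n. E (n + 1)" "G * D"] \<tau>0 \<open>\<tau> \<le> \<tau>0\<close> time[OF J] E D nonneg step by auto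
    then have "(E (J + 1))\<^sup>2 \<le> (K * (G * D))\<^sup>2" using E by (intro power_mono)
    then have "norm_bwd_sq h N (y (J + 1)) \<le> (K * G)\<^sup>2 * D\<^sup>2"
      using norms by (simp add: E_def power_mult_distrib mult.assoc)
    then show "norm_bwd_sq h N (y (J + 1)) \<le> (K * G)\<^sup>2 *
        ((\<Sum>j'=0..J. norm0_sq h N (compact_op (\<lambda>i. f (real i * h) (t_mid \<tau> j'))) * \<tau>)
               + norm0_sq h N (y 0) + norm_bwd_sq h N (y 0))"
      using sum\<phi> norms by (simp add: D_def \<phi>_def)
  qed
qed

end
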